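(* 1. Let $r$ be a universal proper distance matrix and let $(\mathcal{U}_r,\rho_r)$ be the completion of the metric space $(\mathbf{N},r)$. Then $(\mathcal{U}_r,\rho_r)$ is the Urysohn space, i.e. it is a Polish space with the following properties: (1) (Universality) for every Polish space $X$ there exists an isometric embedding of $X$ into $\mathcal{U}_r$; (2) (Homogeneity) for any two isometric finite subsets $A=(a_1,\dots,a_m)$ and $B=(b_1,\dots,b_m)$ of $\mathcal{U}_r$ (with $\rho_r(a_i,a_j)=\rho_r(b_i,b_j)$ for all $i,j$) there exists an isometry $J$ of the whole space $\mathcal{U}_r$ onto itself with $Ja_i=b_i$, $i=1,\dots,m$; (2') for every finite subset $F\subset\mathcal{U}_r$ and every isometric embedding $i$ of $F$ into a finite metric space $F'$ there exists an isometric embedding $I$ of $F'$ into $\mathcal{U}_r$ such that $I\circ i$ is the identity mapping of $F$. 2. (Uniqueness) For any two universal proper distance matrices $r$ and $r'$, the completions of $(\mathbf{N},r)$ and $(\mathbf{N},r')$ are isometric; thus the isometric type of $(\mathcal{U}_r,\rho_r)$ does not depend on the choice of the universal matrix $r$. Moreover, universality is a necessary and sufficient condition for a proper distance matrix to be the distance matrix of a countable everywhere dense subset of the Urysohn space: the distance matrix of any (enumerated) countable everywhere dense subset of the Urysohn space is universal, and conversely, any universal proper distance matrix is the distance matrix of a countable everywhere dense subset of the Urysohn space.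
   Context: A Polish space here is a complete separable metric space. $\mathcal{R}$ is the set of all real matrices $r=\{r_{i,j}\}_{i,j=1}^\infty$ with $r_{i,i}=0$, $r_{i,j}\ge 0$, $r_{i,j}=r_{j,i}$ and $r_{i,k}+r_{k,j}\ge r_{i,j}$ for all $i,j,k$ (distance matrices); $r$ is proper if $r_{i,j}>0$ for $i\ne j$, and then $r$ is a metric on $\mathbf{N}$. For $r\in\mathcal{R}$, $p_n(r)=\{r_{i,j}\}_{i,j=1}^n$. For a distance matrix $q$ of order $n$ put $A(q)=\{(a_1,\dots,a_n)\in\mathbf{R}^n: |a_i-a_j|\le q_{i,j}\le a_i+a_j,\ i,j=1,\dots,n\}$. A matrix $r\in\mathcal{R}$ is called universal if for every $\epsilon>0$, every $n\in\mathbf{N}$ and every $a\in A(p_n(r))$ there exists $m\in\mathbf{N}$ with $\max_{i\le n}|r_{i,m}-a_i|<\epsilon$. The Urysohn space is the Polish space, unique up to isometry, that has the universality property (1) and the homogeneity property (2). The distance matrix of a sequence $\{x_i\}$ in a metric space $(X,\rho)$ is $\{\rho(x_i,x_j)\}_{i,j}$. *)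

theory Defs
  imports "HOL-Analysis.Analysis"
begin

section \<open>Distance matrices\<close>

text \<open>Infinite matrices are functions on \<open>nat \<times> nat\<close>. Indices start at 0, so the index \<open>i \<ge> 1\<close> of
  the usual notation is \<open>i - 1\<close> here, and the upper left corner of order \<open>n\<close> consists of the
  entries with both indices \<open>< n\<close>.\<close>

definition distance_matrices :: "(nat \<Rightarrow> nat \<Rightarrow> real) set" where
  "distance_matrices =
     {r. (\<forall>i. r i i = 0) \<and> (\<forall>i j. 0 \<le> r i j) \<and> (\<forall>i j. r i j = r j i) \<and>
         (\<forall>i j k. r i k + r k j \<ge> r i j)}"

definition proper_matrix :: "(nat \<Rightarrow> nat \<Rightarrow> real) \<Rightarrow> bool" where
  "proper_matrix r \<longleftrightarrow> (\<forall>i j. i \<noteq> j \<longrightarrow> 0 < r i j)"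

text \<open>The set \<open>A(q)\<close> for \<open>q\<close> of order \<open>n\<close>. Only the entries of \<open>q\<close> with indices \<open>< n\<close> and the
  values of \<open>a\<close> at arguments \<open>< n\<close> matter, so no truncation of an infinite matrix is needed.\<close>

definition admissible_vectors :: "nat \<Rightarrow> (nat \<Rightarrow> nat \<Rightarrow> real) \<Rightarrow> (nat \<Rightarrow> real) set" where
  "admissible_vectors n q =
     {a. \<forall>i<n. \<forall>j<n. \<bar>a i - a j\<bar> \<le> q i j \<and> q i j \<le> a i + a j}"

definition universal_matrix :: "(nat \<Rightarrow> nat \<Rightarrow> real) \<Rightarrow> bool" where
  "universal_matrix r \<longleftrightarrow> r \<in> distance_matrices \<and>
     (\<forall>\<epsilon>>0. \<forall>n\<ge>1. \<forall>a\<in>admissible_vectors n r. \<exists>m. \<forall>i<n. \<bar>r i m - a i\<bar> < \<epsilon>)"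

text \<open>The metric space \<open>(\<nat>, r)\<close>; meaningful for proper distance matrices only.\<close>

definition matrix_metric :: "(nat \<Rightarrow> nat \<Rightarrow> real) \<Rightarrow> nat metric" where
  "matrix_metric r = metric (UNIV, r)"

lemma Metric_space_matrix:
  assumes "r \<in> distance_matrices" "proper_matrix r"
  shows "Metric_space UNIV r"
proof
  fix x y z
  show "0 \<le> r x y" "r x y = r y x" "r x z \<le> r x y + r y z"
    using assms(1) unfolding distance_matrices_def by blast+
  have "r x x = 0" "x \<noteq> y \<Longrightarrow> 0 < r x y"
    using assms unfolding distance_matrices_def proper_matrix_def by blast+
  then show "r x y = 0 \<longleftrightarrow> x = y"
    by (cases "x = y") simp_all
qed

lemma mspace_matrix_metric:
  "\<lbrakk>r \<in> distance_matrices; proper_matrix r\<rbrakk> \<Longrightarrow> mspace (matrix_metric r) = UNIV"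
  and mdist_matrix_metric:
  "\<lbrakk>r \<in> distance_matrices; proper_matrix r\<rbrakk> \<Longrightarrow> mdist (matrix_metric r) = r"
  by (simp_all add: matrix_metric_def Metric_space.mspace_metric Metric_space.mdist_metric
      Metric_space_matrix)

section \<open>Isometries, completions, Polish spaces\<close>

definition isometric_embedding :: "'a metric \<Rightarrow> 'b metric \<Rightarrow> ('a \<Rightarrow> 'b) \<Rightarrow> bool" where
  "isometric_embedding X Y f \<longleftrightarrow> f \<in> mspace X \<rightarrow> mspace Y \<and>
     (\<forall>x\<in>mspace X. \<forall>y\<in>mspace X. mdist Y (f x) (f y) = mdist X x y)"

definition isometry_onto :: "'a metric \<Rightarrow> 'b metric \<Rightarrow> ('a \<Rightarrow> 'b) \<Rightarrow> bool" where
  "isometry_onto X Y f \<longleftrightarrow> isometric_embedding X Y f \<and> f ` mspace X = mspace Y"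

definition isometric_spaces :: "'a metric \<Rightarrow> 'b metric \<Rightarrow> bool" where
  "isometric_spaces X Y \<longleftrightarrow> (\<exists>f. isometry_onto X Y f)"

definition is_completion :: "'a metric \<Rightarrow> 'b metric \<Rightarrow> ('a \<Rightarrow> 'b) \<Rightarrow> bool" where
  "is_completion X Y e \<longleftrightarrow> mcomplete_of Y \<and> isometric_embedding X Y e \<and>
     mtopology_of Y closure_of (e ` mspace X) = mspace Y"

lemma completion_exists:
  fixes X :: "'a metric"
  shows "\<exists>(Y :: ('a \<Rightarrow> real) metric) e. is_completion X Y e"
proof -
  obtain e :: "['a, 'a] \<Rightarrow> real" and Y where "mcomplete_of Y" "e \<in> mspace X \<rightarrow> mspace Y"
    "mtopology_of Y closure_of e ` mspace X = mspace Y"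
    "\<And>x y. \<lbrakk>x \<in> mspace X; y \<in> mspace X\<rbrakk> \<Longrightarrow> mdist Y (e x) (e y) = mdist X x y"
    by (metis Metric_space.metric_completion Metric_space_mspace_mdist)
  then have "is_completion X Y e"
    unfolding is_completion_def isometric_embedding_def by simp
  then show ?thesis by blast
qed

definition polish_metric :: "'a metric \<Rightarrow> bool" where
  "polish_metric X \<longleftrightarrow> mcomplete_of X \<and> separable_space (mtopology_of X)"

section \<open>The Urysohn space\<close>

text \<open>Every Polish space embeds isometrically. The quantifier runs over the Polish spaces whose
  points belong to the given type.\<close>

definition polish_universal :: "'x itself \<Rightarrow> 'u metric \<Rightarrow> bool" where
  "polish_universal T U \<longleftrightarrow>
     (\<forall>X :: 'x metric. polish_metric X \<longrightarrow> (\<exists>f. isometric_embedding X U f))"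

definition finite_homogeneous :: "'u metric \<Rightarrow> bool" where
  "finite_homogeneous U \<longleftrightarrow>
     (\<forall>m a b. (\<forall>i<m. a i \<in> mspace U \<and> b i \<in> mspace U) \<and>
              (\<forall>i<m. \<forall>j<m. mdist U (a i) (a j) = mdist U (b i) (b j)) \<longrightarrow>
        (\<exists>J. isometry_onto U U J \<and> (\<forall>i<m::nat. J (a i) = b i)))"

definition finite_extension_property :: "'f itself \<Rightarrow> 'u metric \<Rightarrow> bool" where
  "finite_extension_property T U \<longleftrightarrow>
     (\<forall>F \<iota> (F' :: 'f metric).
        F \<subseteq> mspace U \<and> finite F \<and> finite (mspace F') \<and>
        isometric_embedding (submetric U F) F' \<iota> \<longrightarrow>
        (\<exists>I. isometric_embedding F' U I \<and> (\<forall>x\<in>F. I (\<iota> x) = x)))"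

text \<open>A definition cannot quantify over all types, so universality is required for the Polish
  spaces carried by sets of reals. Since Polish spaces have at most the cardinality of the
  continuum, these represent all Polish spaces up to isometry; see \<open>polish_universal_real\<close>.\<close>

definition urysohn_space :: "'u metric \<Rightarrow> bool" where
  "urysohn_space U \<longleftrightarrow>
     polish_metric U \<and> polish_universal TYPE(real) U \<and> finite_homogeneous U"

lemma polish_lepoll_real:
  fixes X :: "'x metric"
  assumes "polish_metric X"
  shows "mspace X \<lesssim> (UNIV :: real set)"
proof -
  interpret Metric_space "mspace X" "mdist X" by simp
  obtain C where C: "countable C" "C \<subseteq> mspace X" "mtopology closure_of C = mspace X"
    using assms by (auto simp: polish_metric_def separable_space_def mtopology_of_def)
  define B where "B = C \<times> (UNIV :: nat set)"
  define h where "h x = to_nat_on B ` {(c, n) \<in> B. mdist X x c < 1 / Suc n}" for x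
  have "countable B" using C by (simp add: B_def)
  have inj: "inj_on h (mspace X)"
  proof (rule inj_onI, rule ccontr)
    fix x y assume xy: "x \<in> mspace X" "y \<in> mspace X" "h x = h y" "x \<noteq> y"
    then have "0 < mdist X x y / 2" by simp
    then obtain n where n: "1 / Suc n < mdist X x y / 2"
      using nat_approx_posE by blast
    have "x \<in> mtopology closure_of C" using C xy by simp
    then obtain c where c: "c \<in> C" "mdist X x c < 1 / Suc n"
      unfolding metric_closure_of by (smt (verit) in_mball mem_Collect_eq of_nat_0_less_iff
          zero_less_Suc zero_less_divide_1_iff)
    then have "to_nat_on B (c, n) \<in> h x"
      unfolding h_def B_def by (intro imageI) simp
    then have "to_nat_on B (c, n) \<in> h y"
      using xy(3) by simp
    then obtain c' n' where "(c', n') \<in> B" "mdist X y c' < 1 / Suc n'"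
      "to_nat_on B (c, n) = to_nat_on B (c', n')"
      unfolding h_def by auto
    moreover have "(c, n) \<in> B" using c by (simp add: B_def)
    ultimately have "mdist X y c < 1 / Suc n"
      using to_nat_on_inj[OF \<open>countable B\<close>] by auto
    moreover have "mdist X x y \<le> mdist X x c + mdist X c y"
      using xy c C(2) by (intro triangle) auto
    ultimately show False
      using n c(2) by (simp add: commute)
  qed
  then have "mspace X \<lesssim> (UNIV :: nat set set)"
    unfolding lepoll_def by blast
  then show ?thesis
    using nat_sets_eqpoll_reals eqpoll_imp_lepoll lepoll_trans by blast
qed

lemma polish_metric_isometric:
  assumes "isometry_onto X Y f" "polish_metric X"
  shows "polish_metric Y"
proof -
  interpret Metric_space12 "mspace X" "mdist X" "mspace Y" "mdist Y"
    by (simp add: Metric_space12_mspace_mdist)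
  have f: "f ` mspace X = mspace Y"
    "\<And>x y. \<lbrakk>x \<in> mspace X; y \<in> mspace X\<rbrakk> \<Longrightarrow> mdist Y (f x) (f y) = mdist X x y"
    using assms(1) by (auto simp: isometry_onto_def isometric_embedding_def)
  have hom: "homeomorphic_map M1.mtopology M2.mtopology f"
    using isometry_imp_homeomorphic_map f by blast
  then have "separable_space M2.mtopology"
    using assms(2) homeomorphic_separable_space homeomorphic_map_imp_homeomorphic_space
    by (metis mtopology_of_def polish_metric_def)
  moreover have "M2.mcomplete"
    unfolding M2.mcomplete_def
  proof (intro allI impI)
    fix s assume s: "M2.MCauchy s"
    then have "s n \<in> f ` mspace X" for n
      using f(1) by (auto simp: M2.MCauchy_def)
    then have "\<forall>n. \<exists>x. x \<in> mspace X \<and> f x = s n"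
      by (metis imageE)
    then obtain t where t: "\<And>n. t n \<in> mspace X" "\<And>n. f (t n) = s n"
      by metis
    have "mdist X (t m) (t n) = mdist Y (s m) (s n)" for m n
      using f(2)[of "t m" "t n"] t by simp
    then have "M1.MCauchy t"
      using s t(1) unfolding M1.MCauchy_def M2.MCauchy_def by (simp add: image_subset_iff)
    then obtain l where "limitin M1.mtopology t l sequentially"
      using assms(2) by (auto simp: polish_metric_def mcomplete_of_def M1.mcomplete_def)
    then have "limitin M2.mtopology (f \<circ> t) (f l) sequentially"
      by (rule continuous_map_limit[OF homeomorphic_imp_continuous_map[OF hom]])
    then show "\<exists>x. limitin M2.mtopology s x sequentially"
      using t(2) by (auto simp: o_def)
  qed
  ultimately show ?thesis
    by (simp add: polish_metric_def mcomplete_of_def mtopology_of_def)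
qed

lemma polish_universal_real:
  assumes "polish_universal TYPE(real) U"
  shows "polish_universal TYPE('x) U"
  unfolding polish_universal_def
proof (intro allI impI)
  fix X :: "'x metric" assume X: "polish_metric X"
  then obtain g :: "'x \<Rightarrow> real" where g: "inj_on g (mspace X)"
    using polish_lepoll_real by (auto simp: lepoll_def)
  define k where "k = inv_into (mspace X) g"
  have k: "k (g x) = x" if "x \<in> mspace X" for x
    using g that by (simp add: k_def)
  have Y: "Metric_space (g ` mspace X) (\<lambda>u v. mdist X (k u) (k v))"
    by unfold_locales (auto simp: k mdist_commute mdist_triangle)
  define Y where "Y = metric (g ` mspace X, \<lambda>u v. mdist X (k u) (k v))"
  have g_onto: "isometry_onto X Y g"
    unfolding isometry_onto_def isometric_embedding_def Y_def
    by (simp add: Metric_space.mspace_metric[OF Y] Metric_space.mdist_metric[OF Y] k)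
  then obtain f where "isometric_embedding Y U f"
    using assms X polish_metric_isometric polish_universal_def by metis
  then have "isometric_embedding X U (f \<circ> g)"
    using g_onto unfolding isometry_onto_def isometric_embedding_def
    by (auto simp: Pi_iff)
  then show "\<exists>f. isometric_embedding X U f" by blast
qed

text \<open>An everywhere dense sequence; its range is a countable everywhere dense subset. Repetitions
  are not excluded.\<close>

definition dense_sequence :: "'a metric \<Rightarrow> (nat \<Rightarrow> 'a) \<Rightarrow> bool" where
  "dense_sequence X x \<longleftrightarrow> range x \<subseteq> mspace X \<and> mtopology_of X closure_of (range x) = mspace X"

definition distance_matrix :: "'a metric \<Rightarrow> (nat \<Rightarrow> 'a) \<Rightarrow> nat \<Rightarrow> nat \<Rightarrow> real" where
  "distance_matrix X x = (\<lambda>i j. mdist X (x i) (x j))"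

end

theory Submission
  imports Defs
begin

text \<open>Everything rests on the one-point extension property: any admissible vector of distances to
  finitely many points is realized by a point of the space. A dense sequence is universal iff the
  space has this property up to arbitrarily small errors, and in a complete space the errors can be
  removed by successive approximation. Finite partial isometries can then be extended point by point
  along dense sequences: going forth only yields embeddings, going back and forth yields isometries
  between any two Polish spaces with the property.\<close>

text \<open>The one-point extension property mentions only points of \<open>U\<close> and real
  vectors. It involves no auxiliary type, unlike universality for Polish spaces, and can be compared
  directly with universality of a matrix. Two gaps separate it from the latter: a universal matrix
  treats only initial segments of one sequence, and only up to an error. Both are closed by
  enlarging the family of points while keeping the prescribed distances admissible. The last part of
  the claim concerns an arbitrary universal and homogeneous Polish space, so the property must also
  be recovered from these two conditions before such a space can be identified with the completion
  of a universal matrix.\<close>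

lemma mdist_self [simp]: "x \<in> mspace X \<Longrightarrow> mdist X x x = 0"
  by simp

lemma mdist_diff_le:
  assumes "x \<in> mspace X" "y \<in> mspace X" "z \<in> mspace X"
  shows "\<bar>mdist X x z - mdist X y z\<bar> \<le> mdist X x y"
  using Metric_space.mdist_reverse_triangle[OF Metric_space_mspace_mdist, of x X z y] assms
  by (simp add: mdist_commute[of X z y])

text \<open>Later arguments only compare distances, so the limit point is delivered through limits
  of real sequences, whose uniqueness then identifies the distances to it.\<close>

lemma mcomplete_of_limit:
  assumes X: "mcomplete_of X" and s: "\<And>n. s n \<in> mspace X"
    and Cauchy: "\<And>\<epsilon>. \<epsilon> > 0 \<Longrightarrow> \<exists>N. \<forall>m\<ge>N. \<forall>n\<ge>N. mdist X (s m) (s n) < \<epsilon>"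
  obtains l where "l \<in> mspace X"
    "\<And>a. a \<in> mspace X \<Longrightarrow> (\<lambda>k. mdist X a (s k)) \<longlonglongrightarrow> mdist X a l"
proof -
  interpret Metric_space "mspace X" "mdist X" by simp
  have "MCauchy s"
    unfolding MCauchy_def using s Cauchy by blast
  then obtain l where "limitin mtopology s l sequentially"
    using X by (auto simp: mcomplete_of_def mcomplete_def)
  then have l: "l \<in> mspace X" and lim: "(\<lambda>k. mdist X (s k) l) \<longlonglongrightarrow> 0"
    by (auto simp: limitin_metric_dist_null)
  have "(\<lambda>k. mdist X a (s k)) \<longlonglongrightarrow> mdist X a l" if a: "a \<in> mspace X" for a
  proof -
    have "norm (mdist X a (s k) - mdist X a l) \<le> mdist X (s k) l" for k
      using mdist_diff_le[of "s k" X l a] s l a by (simp add: mdist_commute)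
    then have "(\<lambda>k. mdist X a (s k) - mdist X a l) \<longlonglongrightarrow> 0"
      by (intro Lim_null_comparison[OF _ lim]) simp
    then show ?thesis by (simp add: LIM_zero_iff)
  qed
  with l show thesis using that by blast
qed

lemma dense_sequence_iff:
  "dense_sequence X s \<longleftrightarrow>
     range s \<subseteq> mspace X \<and> (\<forall>w\<in>mspace X. \<forall>\<epsilon>>0. \<exists>i. mdist X w (s i) < \<epsilon>)"
proof -
  interpret Metric_space "mspace X" "mdist X" by simp
  have "mtopology_of X closure_of range s = {w \<in> mspace X. \<forall>\<epsilon>>0. \<exists>i. mdist X w (s i) < \<epsilon>}"
    if "range s \<subseteq> mspace X"
    unfolding mtopology_of_def metric_closure_of using that by (auto simp: in_mball image_subset_iff)
  then show ?thesis
    unfolding dense_sequence_def by blast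
qed

lemma separable_dense_sequence:
  assumes "separable_space (mtopology_of X)" "mspace X \<noteq> {}"
  obtains s where "dense_sequence X s"
proof -
  obtain C where C: "countable C" "C \<subseteq> mspace X" "mtopology_of X closure_of C = mspace X"
    using assms(1) by (auto simp: separable_space_def)
  with assms(2) have "C \<noteq> {}" by auto
  with C have "range (from_nat_into C) = C" by simp
  with C have "dense_sequence X (from_nat_into C)"
    by (simp add: dense_sequence_def)
  then show thesis using that by blast
qed

lemma dense_sequence_separable:
  assumes "dense_sequence X s"
  shows "separable_space (mtopology_of X)"
  unfolding separable_space_def
  using assms by (intro exI[of _ "range s"]) (auto simp: dense_sequence_def)

lemma dense_sequence_completion:
  assumes "r \<in> distance_matrices" "proper_matrix r" "is_completion (matrix_metric r) U e"
  shows "dense_sequence U e" "distance_matrix U e = r" "polish_metric U"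
proof -
  show "dense_sequence U e"
    using assms(3) unfolding is_completion_def dense_sequence_def isometric_embedding_def
    by (auto simp: mspace_matrix_metric[OF assms(1,2)])
  then show "polish_metric U"
    using assms(3) dense_sequence_separable by (auto simp: polish_metric_def is_completion_def)
  show "distance_matrix U e = r"
    using assms(3) unfolding is_completion_def isometric_embedding_def distance_matrix_def
    by (simp add: mspace_matrix_metric[OF assms(1,2)] mdist_matrix_metric[OF assms(1,2)])
qed

lemma distance_matrix_in_distance_matrices:
  assumes "range x \<subseteq> mspace X"
  shows "distance_matrix X x \<in> distance_matrices"
proof -
  have "x i \<in> mspace X" for i using assms by auto
  then show ?thesis
    unfolding distance_matrices_def distance_matrix_def
    by (simp add: mdist_triangle) (simp add: mdist_commute)
qed

section \<open>The one-point extension property, approximate and exact\<close>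

text \<open>The family \<open>x\<close> may repeat points: admissibility then forces equal values of
  \<open>a\<close>. The case \<open>n = 0\<close> says that the space is nonempty.\<close>

definition extension_property :: "'u metric \<Rightarrow> bool" where
  "extension_property U \<longleftrightarrow>
     (\<forall>n x a. (\<forall>i<n. x i \<in> mspace U) \<and> a \<in> admissible_vectors n (distance_matrix U x) \<longrightarrow>
        (\<exists>z\<in>mspace U. \<forall>i<n. mdist U (x i) z = a i))"

definition approx_extension_property :: "'u metric \<Rightarrow> bool" where
  "approx_extension_property U \<longleftrightarrow>
     (\<forall>n x a. \<forall>\<epsilon>>0. (\<forall>i<n. x i \<in> mspace U) \<and> a \<in> admissible_vectors n (distance_matrix U x) \<longrightarrow>
        (\<exists>z\<in>mspace U. \<forall>i<n. \<bar>mdist U (x i) z - a i\<bar> < \<epsilon>))"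

text \<open>The witness is the largest 1-Lipschitz function with the prescribed values. The bound on
  differences of \<open>a\<close> preserves these values; the bound on sums makes \<open>f\<close> a
  possible distance to one new point.\<close>

lemma katetov_extension:
  fixes a :: "nat \<Rightarrow> real"
  assumes x: "\<And>i. i < n \<Longrightarrow> x i \<in> mspace U" and n: "n > 0"
    and a: "a \<in> admissible_vectors n (distance_matrix U x)"
  obtains f where "\<And>i. i < n \<Longrightarrow> f (x i) = a i"
    and "\<And>y y'. y \<in> mspace U \<Longrightarrow> y' \<in> mspace U \<Longrightarrow> \<bar>f y - f y'\<bar> \<le> mdist U y y'"
    and "\<And>y y'. y \<in> mspace U \<Longrightarrow> y' \<in> mspace U \<Longrightarrow> mdist U y y' \<le> f y + f y'"
proof -
  define f where "f y = Min ((\<lambda>i. mdist U (x i) y + a i) ` {..<n})" for y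
  have a1: "\<bar>a i - a j\<bar> \<le> mdist U (x i) (x j)" "mdist U (x i) (x j) \<le> a i + a j" if "i < n" "j < n" for i j
    using a that by (auto simp: admissible_vectors_def distance_matrix_def)
  have le: "f y \<le> mdist U (x i) y + a i" if "i < n" for i y
    unfolding f_def using that by (intro Min_le) auto
  have attained: "\<exists>i<n. f y = mdist U (x i) y + a i" for y
  proof -
    have "f y \<in> (\<lambda>i. mdist U (x i) y + a i) ` {..<n}"
      unfolding f_def using n by (intro Min_in) auto
    then show ?thesis by auto
  qed
  have lip: "f y \<le> f y' + mdist U y y'" if y: "y \<in> mspace U" "y' \<in> mspace U" for y y'
  proof -
    obtain i where i: "i < n" "f y' = mdist U (x i) y' + a i" using attained by blast
    have "mdist U (x i) y \<le> mdist U (x i) y' + mdist U y' y"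
      using x i y by (intro mdist_triangle) auto
    with le[of i y] i show ?thesis by (simp add: mdist_commute)
  qed
  show thesis
  proof
    fix i assume i: "i < n"
    obtain j where j: "j < n" "f (x i) = mdist U (x j) (x i) + a j" using attained by blast
    show "f (x i) = a i"
      using le[OF i, of "x i"] a1(1)[OF i j(1)] j(2) mdist_self[OF x[OF i]]
        mdist_commute[of U "x i" "x j"] by linarith
  next
    fix y y' assume y: "y \<in> mspace U" "y' \<in> mspace U"
    show "\<bar>f y - f y'\<bar> \<le> mdist U y y'"
      using lip[of y y'] lip[of y' y] y by (simp add: mdist_commute abs_le_iff)
    obtain i where i: "i < n" "f y = mdist U (x i) y + a i" using attained by blast
    obtain j where j: "j < n" "f y' = mdist U (x j) y' + a j" using attained by blast
    have "mdist U y y' \<le> mdist U y (x i) + mdist U (x i) y'"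
      "mdist U (x i) y' \<le> mdist U (x i) (x j) + mdist U (x j) y'"
      using x y i j by (auto intro!: mdist_triangle)
    then show "mdist U y y' \<le> f y + f y'"
      using a1(2)[of i j] i j by (simp add: mdist_commute)
  qed
qed

text \<open>Universality only speaks about initial segments of the sequence, so the prescribed distances
  are first extended to all of the space by the Katetov function.\<close>

lemma universal_dense_imp_approx:
  assumes s: "dense_sequence U s" and univ: "universal_matrix (distance_matrix U s)"
  shows "approx_extension_property U"
  unfolding approx_extension_property_def
proof (intro allI impI, elim conjE)
  fix n and x :: "nat \<Rightarrow> 'a" and a :: "nat \<Rightarrow> real" and \<epsilon> :: real
  assume \<epsilon>: "\<epsilon> > 0" and x: "\<forall>i<n. x i \<in> mspace U"
    and a: "a \<in> admissible_vectors n (distance_matrix U x)"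
  have sU: "s i \<in> mspace U" for i using s by (auto simp: dense_sequence_def)
  show "\<exists>z\<in>mspace U. \<forall>i<n. \<bar>mdist U (x i) z - a i\<bar> < \<epsilon>"
  proof (cases "n = 0")
    case True
    then show ?thesis using sU by auto
  next
    case False
    then obtain f where fx: "\<And>i. i < n \<Longrightarrow> f (x i) = a i"
      and f1: "\<And>y y'. y \<in> mspace U \<Longrightarrow> y' \<in> mspace U \<Longrightarrow> \<bar>f y - f y'\<bar> \<le> mdist U y y'"
      and f2: "\<And>y y'. y \<in> mspace U \<Longrightarrow> y' \<in> mspace U \<Longrightarrow> mdist U y y' \<le> f y + f y'"
      using katetov_extension[of n x U a] x a by auto
    \<comment> \<open>Three errors add up: replacing \<open>x i\<close> by a term of
      \<open>s\<close> in the distance, the same replacement in \<open>f\<close>, and the error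
      granted by universality.\<close>
    have "\<forall>i. \<exists>k. i < n \<longrightarrow> mdist U (x i) (s k) < \<epsilon> / 3"
      using s x \<epsilon> unfolding dense_sequence_iff by (meson divide_pos_pos zero_less_numeral)
    then obtain k where k: "\<And>i. i < n \<Longrightarrow> mdist U (x i) (s (k i)) < \<epsilon> / 3" by metis
    define N where "N = Suc (Max (k ` {..<n}))"
    have kN: "k i < N" if "i < n" for i
      unfolding N_def using that by (simp add: less_Suc_eq_le)
    have "f \<circ> s \<in> admissible_vectors N (distance_matrix U s)"
      unfolding admissible_vectors_def distance_matrix_def using f1 f2 sU by auto
    moreover have "N \<ge> 1" by (simp add: N_def)
    moreover have "\<epsilon> / 3 > 0" using \<epsilon> by simp
    ultimately obtain m where m: "\<And>j. j < N \<Longrightarrow> \<bar>distance_matrix U s j m - (f \<circ> s) j\<bar> < \<epsilon> / 3"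
      using univ[unfolded universal_matrix_def] by blast
    have "\<bar>mdist U (x i) (s m) - a i\<bar> < \<epsilon>" if i: "i < n" for i
    proof -
      have "\<bar>mdist U (s (k i)) (s m) - f (s (k i))\<bar> < \<epsilon> / 3"
        using m[OF kN[OF i]] by (simp add: distance_matrix_def)
      moreover have "\<bar>mdist U (x i) (s m) - mdist U (s (k i)) (s m)\<bar> \<le> mdist U (x i) (s (k i))"
        using x i sU by (intro mdist_diff_le) auto
      moreover have "\<bar>f (x i) - f (s (k i))\<bar> \<le> mdist U (x i) (s (k i))"
        using x i sU by (intro f1) auto
      ultimately show ?thesis
        using k[OF i] fx[OF i] by linarith
    qed
    with sU show ?thesis by blast
  qed
qed

text \<open>A term of \<open>s\<close> close to the exact solution has nearly the right distance to
  every \<open>s i\<close> at once.\<close>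

lemma extension_property_imp_universal:
  assumes U: "extension_property U" and s: "dense_sequence U s"
  shows "universal_matrix (distance_matrix U s)"
  unfolding universal_matrix_def
proof (intro conjI allI impI ballI)
  have sU: "s i \<in> mspace U" for i using s by (auto simp: dense_sequence_def)
  then show "distance_matrix U s \<in> distance_matrices"
    by (intro distance_matrix_in_distance_matrices) auto
  fix \<epsilon> :: real and n :: nat and a
  assume \<epsilon>: "\<epsilon> > 0" and a: "a \<in> admissible_vectors n (distance_matrix U s)"
  then obtain z where z: "z \<in> mspace U" "\<forall>i<n. mdist U (s i) z = a i"
    using U[unfolded extension_property_def, rule_format, of n s a] sU by blast
  obtain m where m: "mdist U z (s m) < \<epsilon>"
    using s z(1) \<epsilon> unfolding dense_sequence_iff by blast
  have "\<bar>mdist U (s i) (s m) - mdist U (s i) z\<bar> < \<epsilon>" for i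
    using mdist_diff_le[of z U "s m" "s i"] m z(1) sU by (simp add: mdist_commute abs_minus_commute)
  with z(2) show "\<exists>m. \<forall>i<n. \<bar>distance_matrix U s i m - a i\<bar> < \<epsilon>"
    unfolding distance_matrix_def by metis
qed

text \<open>The error of \<open>z\<close> is itself an admissible distance from \<open>z\<close> to the sought point, so the next
  approximation can be taken close to \<open>z\<close>.\<close>

lemma approx_extension_step:
  assumes U: "approx_extension_property U" and x: "\<And>i. i < n \<Longrightarrow> x i \<in> mspace U"
    and a: "a \<in> admissible_vectors n (distance_matrix U x)"
    and z: "z \<in> mspace U" "\<And>i. i < n \<Longrightarrow> \<bar>mdist U (x i) z - a i\<bar> < \<epsilon>" and "\<epsilon> > 0" "\<epsilon>' > 0"
  obtains z' where "z' \<in> mspace U" "\<And>i. i < n \<Longrightarrow> \<bar>mdist U (x i) z' - a i\<bar> < \<epsilon>'"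
    "mdist U z z' < \<epsilon> + \<epsilon>'"
proof -
  have a1: "\<bar>a i - a j\<bar> \<le> mdist U (x i) (x j)" "mdist U (x i) (x j) \<le> a i + a j" if "i < n" "j < n" for i j
    using a that by (auto simp: admissible_vectors_def distance_matrix_def)
  \<comment> \<open>Under these conditions \<open>a\<close> stays admissible when \<delta> is
    prescribed as the distance to \<open>z\<close>. The largest error qualifies, and
    \<open>0\<close> does if there are no points.\<close>
  obtain \<delta> where \<delta>: "0 \<le> \<delta>" "\<delta> < \<epsilon>" "\<And>i. i < n \<Longrightarrow> \<bar>mdist U (x i) z - a i\<bar> \<le> \<delta>"
    "\<And>i. i < n \<Longrightarrow> \<delta> \<le> mdist U (x i) z + a i"
  proof (cases "n = 0")
    case True
    then show ?thesis using that[of 0] \<open>\<epsilon> > 0\<close> by simp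
  next
    case False
    define D where "D = (\<lambda>i. \<bar>mdist U (x i) z - a i\<bar>) ` {..<n}"
    have D: "finite D" "D \<noteq> {}" using False by (auto simp: D_def)
    have "Max D \<in> D" using D by (rule Max_in)
    then obtain j where j: "j < n" "Max D = \<bar>mdist U (x j) z - a j\<bar>"
      unfolding D_def by blast
    \<comment> \<open>The detour through \<open>x i\<close> and the admissibility of the pair
      \<open>i\<close>, \<open>j\<close> bound the error at \<open>j\<close>, whatever its
      sign.\<close>
    have "Max D \<le> mdist U (x i) z + a i" if i: "i < n" for i
    proof -
      have "mdist U (x j) z \<le> mdist U (x j) (x i) + mdist U (x i) z"
        "mdist U (x j) (x i) \<le> mdist U (x j) z + mdist U z (x i)"
        using x z(1) i j(1) by (auto intro!: mdist_triangle)
      then show ?thesis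
        using a1[OF i j(1)] j(2) by (simp add: mdist_commute)
    qed
    moreover have "\<bar>mdist U (x i) z - a i\<bar> \<le> Max D" if "i < n" for i
      using D that by (intro Max_ge) (auto simp: D_def)
    ultimately show ?thesis using that[of "Max D"] j z(2) by (metis abs_ge_zero)
  qed
  define x' where "x' = x(n := z)"
  define a' where "a' = a(n := \<delta>)"
  have "a' \<in> admissible_vectors (Suc n) (distance_matrix U x')"
    unfolding admissible_vectors_def distance_matrix_def
  proof clarify
    fix i j assume "i < Suc n" "j < Suc n"
    then consider "i < n" "j < n" | "i < n" "j = n" | "i = n" "j < n" | "i = n" "j = n"
      by linarith
    then show "\<bar>a' i - a' j\<bar> \<le> mdist U (x' i) (x' j) \<and> mdist U (x' i) (x' j) \<le> a' i + a' j"
    proof cases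
      case 1
      then show ?thesis
        using a1 by (simp add: a'_def x'_def)
    next
      case 2
      then show ?thesis
        using \<delta>(3,4)[of i] by (simp add: a'_def x'_def abs_le_iff)
    next
      case 3
      then show ?thesis
        using \<delta>(3,4)[of j] by (simp add: a'_def x'_def abs_le_iff mdist_commute[of U z])
    next
      case 4
      then show ?thesis
        using \<delta>(1) z(1) by (simp add: a'_def x'_def)
    qed
  qed
  moreover have "\<forall>i<Suc n. x' i \<in> mspace U"
    using x z(1) by (auto simp: x'_def less_Suc_eq)
  ultimately obtain z' where z': "z' \<in> mspace U" "\<forall>i<Suc n. \<bar>mdist U (x' i) z' - a' i\<bar> < \<epsilon>'"
    using U[unfolded approx_extension_property_def, rule_format, of \<epsilon>' "Suc n" x' a'] \<open>\<epsilon>' > 0\<close> by blast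
  have "\<bar>mdist U (x i) z' - a i\<bar> < \<epsilon>'" if "i < n" for i
    using z'(2)[rule_format, of i] that by (simp add: x'_def a'_def)
  moreover have "\<bar>mdist U z z' - \<delta>\<bar> < \<epsilon>'"
    using z'(2)[rule_format, of n] by (simp add: x'_def a'_def)
  ultimately show thesis
    using that[OF z'(1)] \<delta>(2) by force
qed

text \<open>Approximate solutions chosen independently need not converge. Each is therefore taken
  near its predecessor, within the sum of the two errors; since the errors halve, the steps are
  summable.\<close>

lemma extension_property_if_approx:
  assumes U: "mcomplete_of U" "approx_extension_property U"
  shows "extension_property U"
  unfolding extension_property_def
proof (intro allI impI, elim conjE)
  fix n and x :: "nat \<Rightarrow> 'a" and a :: "nat \<Rightarrow> real"
  assume x: "\<forall>i<n. x i \<in> mspace U" and a: "a \<in> admissible_vectors n (distance_matrix U x)"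
  define \<eta> :: "nat \<Rightarrow> real" where "\<eta> k = (1/2) ^ k" for k
  have \<eta>: "\<eta> k > 0" "\<eta> (Suc k) = \<eta> k / 2" for k by (simp_all add: \<eta>_def)
  have \<eta>_lim: "\<eta> \<longlonglongrightarrow> 0" unfolding \<eta>_def by (rule LIMSEQ_power_zero) simp
  define P where "P k z \<longleftrightarrow> z \<in> mspace U \<and> (\<forall>i<n. \<bar>mdist U (x i) z - a i\<bar> < \<eta> k)" for k z
  have "\<exists>z. \<forall>k. P k (z k) \<and> mdist U (z k) (z (Suc k)) < 2 * \<eta> k"
  proof (rule dependent_nat_choice)
    show "\<exists>z. P 0 z"
      using U(2) x a \<eta>(1)[of 0] unfolding approx_extension_property_def P_def by blast
  next
    fix z k assume z: "P k z"
    then obtain z' where "z' \<in> mspace U" "\<And>i. i < n \<Longrightarrow> \<bar>mdist U (x i) z' - a i\<bar> < \<eta> (Suc k)"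
      "mdist U z z' < \<eta> k + \<eta> (Suc k)"
      using approx_extension_step[OF U(2), of n x a z "\<eta> k" "\<eta> (Suc k)"] x a \<eta>(1)
      unfolding P_def by metis
    then have "P (Suc k) z' \<and> mdist U z z' < 2 * \<eta> k"
      using \<eta>(1)[of k] by (simp add: P_def \<eta>(2))
    then show "\<exists>z'. P (Suc k) z' \<and> mdist U z z' < 2 * \<eta> k" by blast
  qed
  then obtain z where z: "\<And>k. z k \<in> mspace U"
    "\<And>k i. i < n \<Longrightarrow> \<bar>mdist U (x i) (z k) - a i\<bar> < \<eta> k"
    "\<And>k. mdist U (z k) (z (Suc k)) < 2 * \<eta> k"
    unfolding P_def by blast
  \<comment> \<open>The step bound \<open>2 * \<eta> k\<close> equals
    \<open>4 * \<eta> k - 4 * \<eta> (Suc k)\<close>, so the sum telescopes.\<close>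
  have geometric: "mdist U (z m) (z (m + k)) \<le> 4 * \<eta> m - 4 * \<eta> (m + k)" for m k
  proof (induction k)
    case 0
    show ?case using mdist_self[OF z(1)] by simp
  next
    case (Suc k)
    have "mdist U (z m) (z (m + Suc k)) \<le> mdist U (z m) (z (m + k)) + mdist U (z (m + k)) (z (m + Suc k))"
      using z(1) by (intro mdist_triangle)
    then show ?case using Suc.IH z(3)[of "m + k"] by (simp add: \<eta>(2))
  qed
  have bound: "mdist U (z m) (z k) < 4 * \<eta> m" if "m \<le> k" for m k
    using geometric[of m "k - m"] \<eta>(1)[of k] that by simp
  have "\<exists>N. \<forall>m\<ge>N. \<forall>k\<ge>N. mdist U (z m) (z k) < \<epsilon>" if \<epsilon>: "\<epsilon> > 0" for \<epsilon>
  proof -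
    \<comment> \<open>Two distances from \<open>z N\<close>, each below \<open>4 * \<eta> N\<close>,
      must add up to less than \<epsilon>.\<close>
    obtain N where N: "\<eta> N < \<epsilon> / 8"
      using order_tendstoD(2)[OF \<eta>_lim, of "\<epsilon> / 8"] \<epsilon> by (auto simp: eventually_sequentially)
    have "mdist U (z m) (z k) < \<epsilon>" if "m \<ge> N" "k \<ge> N" for m k
    proof -
      have "mdist U (z m) (z k) \<le> mdist U (z m) (z N) + mdist U (z N) (z k)"
        using z(1) by (intro mdist_triangle)
      then show ?thesis
        using bound[OF that(1)] bound[OF that(2)] N by (simp add: mdist_commute)
    qed
    then show ?thesis by blast
  qed
  then obtain l where l: "l \<in> mspace U"
    "\<And>w. w \<in> mspace U \<Longrightarrow> (\<lambda>k. mdist U w (z k)) \<longlonglongrightarrow> mdist U w l"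
    using mcomplete_of_limit[OF U(1), of z] z(1) by blast
  have "mdist U (x i) l = a i" if i: "i < n" for i
  proof -
    have "(\<lambda>k. mdist U (x i) (z k) - a i) \<longlonglongrightarrow> 0"
      by (rule Lim_null_comparison[OF _ \<eta>_lim]) (use z(2)[OF i] in \<open>simp add: less_imp_le\<close>)
    then have "(\<lambda>k. mdist U (x i) (z k)) \<longlonglongrightarrow> a i" by (simp add: LIM_zero_iff)
    then show ?thesis using l(2) x i LIMSEQ_unique by blast
  qed
  with l(1) show "\<exists>z\<in>mspace U. \<forall>i<n. mdist U (x i) z = a i" by blast
qed

section \<open>Isometries determined on dense sequences\<close>

text \<open>Terms of \<open>s\<close> approaching \<open>w\<close> have counterparts in
  \<open>t\<close> that form a Cauchy sequence by \<open>eq\<close>; their limit is the counterpart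
  of \<open>w\<close>. Working with indices avoids the question of a well-defined map when
  \<open>s\<close> repeats points.\<close>

lemma dense_point_transfer:
  assumes s: "dense_sequence X s" and V: "mcomplete_of V" and t: "range t \<subseteq> mspace V"
    and eq: "\<And>i j. mdist V (t i) (t j) = mdist X (s i) (s j)" and w: "w \<in> mspace X"
  shows "\<exists>v\<in>mspace V. \<forall>i. mdist V (t i) v = mdist X (s i) w"
proof -
  have sX: "s i \<in> mspace X" and tV: "t i \<in> mspace V" for i
    using s t by (auto simp: dense_sequence_def)
  have "\<forall>k. \<exists>i. mdist X w (s i) < 1 / Suc k"
    using s w unfolding dense_sequence_iff by simp
  then obtain \<sigma> where \<sigma>: "\<And>k. mdist X w (s (\<sigma> k)) < 1 / Suc k" by metis
  have lim0: "(\<lambda>k. 1 / real (Suc k)) \<longlonglongrightarrow> 0"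
    using LIMSEQ_inverse_real_of_nat by (simp add: inverse_eq_divide)
  have "\<exists>N. \<forall>m\<ge>N. \<forall>n\<ge>N. mdist V (t (\<sigma> m)) (t (\<sigma> n)) < \<epsilon>" if "\<epsilon> > 0" for \<epsilon>
  proof -
    obtain N where N: "\<And>k. k \<ge> N \<Longrightarrow> 1 / real (Suc k) < \<epsilon> / 2"
      using order_tendstoD(2)[OF lim0 half_gt_zero[OF \<open>\<epsilon> > 0\<close>]]
      unfolding eventually_sequentially by blast
    have "mdist V (t (\<sigma> m)) (t (\<sigma> n)) < \<epsilon>" if "m \<ge> N" "n \<ge> N" for m n
    proof -
      have "mdist X (s (\<sigma> m)) (s (\<sigma> n)) \<le> mdist X (s (\<sigma> m)) w + mdist X w (s (\<sigma> n))"
        using sX w by (intro mdist_triangle)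
      then show ?thesis
        using \<sigma>[of m] \<sigma>[of n] N[OF that(1)] N[OF that(2)] eq by (simp add: mdist_commute)
    qed
    then show ?thesis by blast
  qed
  then obtain v where v: "v \<in> mspace V"
    "\<And>b. b \<in> mspace V \<Longrightarrow> (\<lambda>k. mdist V b (t (\<sigma> k))) \<longlonglongrightarrow> mdist V b v"
    using mcomplete_of_limit[OF V, of "\<lambda>k. t (\<sigma> k)"] tV by blast
  have "mdist V (t i) v = mdist X (s i) w" for i
  proof -
    have "norm (mdist V (t i) (t (\<sigma> k)) - mdist X (s i) w) \<le> 1 / Suc k" for k
      using mdist_diff_le[of "s (\<sigma> k)" X w "s i"] \<sigma>[of k] sX w eq by (simp add: mdist_commute)
    then have "(\<lambda>k. mdist V (t i) (t (\<sigma> k)) - mdist X (s i) w) \<longlonglongrightarrow> 0"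
      by (intro Lim_null_comparison[OF _ lim0]) simp
    then have "(\<lambda>k. mdist V (t i) (t (\<sigma> k))) \<longlonglongrightarrow> mdist X (s i) w"
      by (simp add: LIM_zero_iff)
    then show ?thesis using v(2)[OF tV] LIMSEQ_unique by blast
  qed
  with v(1) show ?thesis by blast
qed

text \<open>A term \<open>s i\<close> near \<open>w\<close> has a counterpart \<open>t i\<close>
  equally near \<open>v\<close>, so both distances are approximated by the common value at index
  \<open>i\<close>.\<close>

lemma mdist_eq_via_dense:
  assumes t: "range t \<subseteq> mspace V" and v: "v \<in> mspace V" "v' \<in> mspace V"
    and s: "dense_sequence X s" and w: "w \<in> mspace X" "w' \<in> mspace X"
    and eq: "\<And>i. mdist V (t i) v = mdist X (s i) w" "\<And>i. mdist V (t i) v' = mdist X (s i) w'"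
  shows "mdist V v v' = mdist X w w'"
proof (rule ccontr)
  have sX: "s i \<in> mspace X" and tV: "t i \<in> mspace V" for i
    using s t by (auto simp: dense_sequence_def)
  assume "mdist V v v' \<noteq> mdist X w w'"
  \<comment> \<open>Half of the discrepancy, because the error is made once in each space.\<close>
  then have "\<bar>mdist V v v' - mdist X w w'\<bar> / 2 > 0" by simp
  then obtain i where i: "mdist X w (s i) < \<bar>mdist V v v' - mdist X w w'\<bar> / 2"
    using s w(1) unfolding dense_sequence_iff by blast
  have "\<bar>mdist V (t i) v' - mdist V v v'\<bar> \<le> mdist V (t i) v"
    "\<bar>mdist X (s i) w' - mdist X w w'\<bar> \<le> mdist X (s i) w"
    using sX tV v w by (auto intro!: mdist_diff_le)
  then show False using i eq[of i] by (simp add: mdist_commute)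
qed

text \<open>The map is chosen point by point through distances to the dense terms, and these
  determine all other distances. Surjectivity is conditional so that the lemma serves both going
  forth and going back and forth.\<close>

lemma isometric_embedding_from_dense:
  assumes s: "dense_sequence X s" and V: "mcomplete_of V" and t: "range t \<subseteq> mspace V"
    and eq: "\<And>i j. mdist V (t i) (t j) = mdist X (s i) (s j)"
  obtains f where "isometric_embedding X V f" "\<And>i. f (s i) = t i"
    "mcomplete_of X \<Longrightarrow> dense_sequence V t \<Longrightarrow> isometry_onto X V f"
proof -
  have sX: "s i \<in> mspace X" and tV: "t i \<in> mspace V" for i
    using s t by (auto simp: dense_sequence_def)
  obtain f where f: "\<And>w. w \<in> mspace X \<Longrightarrow> f w \<in> mspace V"
    "\<And>w i. w \<in> mspace X \<Longrightarrow> mdist V (t i) (f w) = mdist X (s i) w"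
    using dense_point_transfer[OF s V t eq] by metis
  have emb: "isometric_embedding X V f"
    unfolding isometric_embedding_def using f mdist_eq_via_dense[OF t _ _ s] by auto
  moreover have "f (s i) = t i" for i
    using f(2)[OF sX, of i i] mdist_zero[OF tV f(1)[OF sX], of i i] sX[of i] by simp
  moreover have "isometry_onto X V f" if X: "mcomplete_of X" and dense: "dense_sequence V t"
    unfolding isometry_onto_def
  proof (intro conjI emb equalityI subsetI)
    fix v assume v: "v \<in> mspace V"
    \<comment> \<open>The same transfer with the roles of \<open>X\<close> and \<open>V\<close>
      exchanged supplies the preimage.\<close>
    obtain w where w: "w \<in> mspace X" "\<And>i. mdist X (s i) w = mdist V (t i) v"
      using dense_point_transfer[OF dense X _ _ v, of s] eq sX by (metis image_subsetI)
    have "mdist V (f w) v = mdist X w w"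
      by (rule mdist_eq_via_dense[OF t f(1)[OF w(1)] v s w(1) w(1)]) (use w f(2) in auto)
    then have "f w = v" using f(1)[OF w(1)] v w(1) mdist_zero by fastforce
    with w(1) show "v \<in> f ` mspace X" by blast
  qed (use f in auto)
  ultimately show thesis using that by blast
qed

section \<open>Extension of finite partial isometries\<close>

text \<open>Distances to an actual point are admissible by the triangle inequality, and
  \<open>eq\<close> carries this over to \<open>V\<close>.\<close>

lemma extend_partial_isometry:
  fixes n :: nat
  assumes V: "extension_property V" and x: "\<And>i. i < n \<Longrightarrow> x i \<in> mspace X"
    and y: "\<And>i. i < n \<Longrightarrow> y i \<in> mspace V"
    and eq: "\<And>i j. i < n \<Longrightarrow> j < n \<Longrightarrow> mdist V (y i) (y j) = mdist X (x i) (x j)"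
    and u: "u \<in> mspace X"
  shows "\<exists>v\<in>mspace V. \<forall>i<n. mdist V (y i) v = mdist X (x i) u"
proof -
  have "\<bar>mdist X (x i) u - mdist X (x j) u\<bar> \<le> mdist X (x i) (x j)"
    "mdist X (x i) (x j) \<le> mdist X (x i) u + mdist X (x j) u" if "i < n" "j < n" for i j
    using mdist_diff_le[OF x[OF that(1)] x[OF that(2)] u]
      mdist_triangle[OF x[OF that(1)] u x[OF that(2)]] mdist_commute[of X u "x j"] by simp_all
  then have "(\<lambda>i. mdist X (x i) u) \<in> admissible_vectors n (distance_matrix V y)"
    unfolding admissible_vectors_def distance_matrix_def by (simp add: eq)
  then show ?thesis
    using V[unfolded extension_property_def, rule_format, of n y "\<lambda>i. mdist X (x i) u"] y by blast
qed

lemma extend_to_embedding: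
  fixes m :: nat
  assumes V: "mcomplete_of V" "extension_property V"
    and X: "separable_space (mtopology_of X)" "mspace X \<noteq> {}"
    and x: "\<And>i. i < m \<Longrightarrow> x i \<in> mspace X" and y: "\<And>i. i < m \<Longrightarrow> y i \<in> mspace V"
    and eq: "\<And>i j. i < m \<Longrightarrow> j < m \<Longrightarrow> mdist V (y i) (y j) = mdist X (x i) (x j)"
  shows "\<exists>f. isometric_embedding X V f \<and> (\<forall>i<m. f (x i) = y i)"
proof -
  obtain p where p: "dense_sequence X p" using separable_dense_sequence[OF X] .
  \<comment> \<open>The prescribed points come first, so their images are settled before any choice
    is made.\<close>
  define s where "s n = (if n < m then x n else p (n - m))" for n
  have sX: "s n \<in> mspace X" for n
    using p x by (auto simp: s_def dense_sequence_def)
  have sp: "s (m + n) = p n" for n by (simp add: s_def)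
  have s: "dense_sequence X s"
    using p sX unfolding dense_sequence_iff by (metis sp image_subsetI)
  define P where "P t n v \<longleftrightarrow> v \<in> mspace V \<and>
      (\<forall>i<n. mdist V (t i) v = mdist X (s i) (s n)) \<and> (n < m \<longrightarrow> v = y n)" for t n v
  \<comment> \<open>A new image must fit all earlier ones, so the choice depends on the whole
    initial segment; \<open>P t n\<close> reads \<open>t\<close> only below
    \<open>n\<close>.\<close>
  have "\<exists>t. \<forall>n. P t n (t n)"
  proof (rule dependent_wellorder_choice)
    fix v t t' and n :: nat assume "\<And>i. i < n \<Longrightarrow> t i = (t' i :: 'a)"
    then show "P t n v = P t' n v" by (simp add: P_def)
  next
    fix n :: nat and t assume IH: "\<And>i. i < n \<Longrightarrow> P t i (t i)"
    show "\<exists>v. P t n v"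
    proof (cases "n < m")
      case True
      have "mdist V (t i) (y n) = mdist X (s i) (s n)" if "i < n" for i
        using IH[OF that] that True eq by (simp add: P_def s_def)
      with True y show ?thesis by (auto simp: P_def)
    next
      case False
      have "mdist V (t i) (t j) = mdist X (s i) (s j)" if "i < n" "j < n" for i j
        using IH[OF that(1)] IH[OF that(2)] sX
        by (cases i j rule: linorder_cases) (auto simp: P_def mdist_commute)
      then have "\<exists>v\<in>mspace V. \<forall>i<n. mdist V (t i) v = mdist X (s i) (s n)"
        using IH sX by (intro extend_partial_isometry[OF V(2)]) (auto simp: P_def)
      with False show ?thesis by (auto simp: P_def)
    qed
  qed
  then obtain t where t: "\<And>n. P t n (t n)" by blast
  have tV: "t n \<in> mspace V" for n using t by (simp add: P_def)
  have teq: "mdist V (t i) (t j) = mdist X (s i) (s j)" for i j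
    using t[of i] t[of j] tV sX
    by (cases i j rule: linorder_cases) (auto simp: P_def mdist_commute)
  obtain f where f: "isometric_embedding X V f" "\<And>i. f (s i) = t i"
    using isometric_embedding_from_dense[OF s V(1) _ teq] tV by blast
  have "f (x i) = y i" if "i < m" for i
    using f(2)[of i] t[of i] that by (simp add: P_def s_def)
  with f(1) show ?thesis by blast
qed

text \<open>Back and forth: of the steps \<open>m + k\<close>, those with even \<open>k\<close> exhaust a dense sequence of \<open>U\<close>
  and those with odd \<open>k\<close> one of \<open>V\<close>.\<close>

lemma extend_to_isometry:
  fixes U :: "'u metric" and V :: "'v metric" and m :: nat
  assumes U: "polish_metric U" "extension_property U" and V: "polish_metric V" "extension_property V"
    and x: "\<And>i. i < m \<Longrightarrow> x i \<in> mspace U" and y: "\<And>i. i < m \<Longrightarrow> y i \<in> mspace V"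
    and eq: "\<And>i j. i < m \<Longrightarrow> j < m \<Longrightarrow> mdist U (x i) (x j) = mdist V (y i) (y j)"
  shows "\<exists>J. isometry_onto U V J \<and> (\<forall>i<m. J (x i) = y i)"
proof -
  have nonempty: "mspace W \<noteq> {}" if "extension_property W" for W :: "'w metric"
    using that[unfolded extension_property_def, rule_format, of 0]
    by (auto simp: admissible_vectors_def)
  obtain p where p: "dense_sequence U p"
    using separable_dense_sequence U nonempty by (metis polish_metric_def)
  obtain q where q: "dense_sequence V q"
    using separable_dense_sequence V nonempty by (metis polish_metric_def)
  have pU: "p n \<in> mspace U" and qV: "q n \<in> mspace V" for n
    using p q by (auto simp: dense_sequence_def)
  define P where "P f n z \<longleftrightarrow> fst z \<in> mspace U \<and> snd z \<in> mspace V \<and>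
      (\<forall>i<n. mdist U (fst (f i)) (fst z) = mdist V (snd (f i)) (snd z)) \<and>
      (n < m \<longrightarrow> z = (x n, y n)) \<and>
      (\<forall>k. n = m + 2 * k \<longrightarrow> fst z = p k) \<and> (\<forall>k. n = m + Suc (2 * k) \<longrightarrow> snd z = q k)"
    for f :: "nat \<Rightarrow> 'u \<times> 'v" and n z
  have Peq: "mdist U (fst (f i)) (fst (f j)) = mdist V (snd (f i)) (snd (f j))"
    if "P f i (f i)" "P f j (f j)" for f i j
    using that by (cases i j rule: linorder_cases) (auto simp: P_def mdist_commute)
  have "\<exists>f. \<forall>n. P f n (f n)"
  proof (rule dependent_wellorder_choice)
    fix z f f' and n :: nat assume "\<And>i. i < n \<Longrightarrow> f i = (f' i :: 'u \<times> 'v)"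
    then show "P f n z = P f' n z" by (simp add: P_def)
  next
    fix n :: nat and f assume IH: "\<And>i. i < n \<Longrightarrow> P f i (f i)"
    consider "n < m" | k where "n = m + 2 * k" | k where "n = m + Suc (2 * k)"
      by (metis add.commute add_Suc_right evenE le_Suc_ex not_less oddE plus_1_eq_Suc)
    then show "\<exists>z. P f n z"
    proof cases
      case 1
      have "mdist U (fst (f i)) (x n) = mdist V (snd (f i)) (y n)" if "i < n" for i
        using IH[OF that] that 1 eq by (simp add: P_def)
      with 1 x y have "P f n (x n, y n)" by (simp add: P_def)
      then show ?thesis ..
    next
      case (2 k)
      have "\<exists>v\<in>mspace V. \<forall>i<n. mdist V (snd (f i)) v = mdist U (fst (f i)) (p k)"
        using IH pU Peq by (intro extend_partial_isometry[OF V(2)]) (auto simp: P_def)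
      then obtain v where "v \<in> mspace V" "\<forall>i<n. mdist V (snd (f i)) v = mdist U (fst (f i)) (p k)"
        by blast
      \<comment> \<open>Parity makes the clause for \<open>q\<close> vacuous, and \<open>n\<close>
        determines \<open>k\<close>.\<close>
      then have "P f n (p k, v)" using pU 2 by (auto simp: P_def) presburger+
      then show ?thesis ..
    next
      case (3 k)
      have "\<exists>u\<in>mspace U. \<forall>i<n. mdist U (fst (f i)) u = mdist V (snd (f i)) (q k)"
        using IH qV Peq by (intro extend_partial_isometry[OF U(2)]) (auto simp: P_def)
      then obtain u where "u \<in> mspace U" "\<forall>i<n. mdist U (fst (f i)) u = mdist V (snd (f i)) (q k)"
        by blast
      then have "P f n (u, q k)" using qV 3 by (auto simp: P_def) presburger+
      then show ?thesis ..
    qed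
  qed
  then obtain f where f: "\<And>n. P f n (f n)" by blast
  define s t where "s = (\<lambda>n. fst (f n))" and "t = (\<lambda>n. snd (f n))"
  have sU: "s n \<in> mspace U" and tV: "t n \<in> mspace V" for n
    using f[of n] by (simp_all add: P_def s_def t_def)
  have "s (m + 2 * k) = p k" "t (m + Suc (2 * k)) = q k" for k
    using f[of "m + 2 * k"] f[of "m + Suc (2 * k)"] unfolding P_def s_def t_def by blast+
  \<comment> \<open>\<open>s\<close> runs through \<open>p\<close> and \<open>t\<close> through
    \<open>q\<close>, which makes both dense.\<close>
  then have s: "dense_sequence U s" and t: "dense_sequence V t"
    using p q sU tV unfolding dense_sequence_iff by (metis image_subsetI)+
  have steq: "mdist V (t i) (t j) = mdist U (s i) (s j)" for i j
    using Peq[OF f f, of i j] by (simp add: s_def t_def)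
  obtain J where J: "isometry_onto U V J" "\<And>i. J (s i) = t i"
    using isometric_embedding_from_dense[OF s _ _ steq] U(1) V(1) t tV
    by (metis polish_metric_def image_subsetI)
  have "J (x i) = y i" if "i < m" for i
    using J(2)[of i] f[of i] that by (simp add: P_def s_def t_def)
  with J(1) show ?thesis by blast
qed

section \<open>One-point extension against universality, homogeneity and finite extension\<close>

lemma extension_property_homogeneous:
  assumes "polish_metric U" "extension_property U"
  shows "finite_homogeneous U"
  unfolding finite_homogeneous_def
proof (intro allI impI, elim conjE)
  fix m :: nat and a b
  assume "\<forall>i<m. a i \<in> mspace U \<and> b i \<in> mspace U"
    "\<forall>i<m. \<forall>j<m. mdist U (a i) (a j) = mdist U (b i) (b j)"
  then show "\<exists>J. isometry_onto U U J \<and> (\<forall>i<m::nat. J (a i) = b i)"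
    by (intro extend_to_isometry[OF assms assms]) auto
qed

lemma extension_property_polish_universal:
  assumes "mcomplete_of U" "extension_property U"
  shows "polish_universal TYPE('x) U"
  unfolding polish_universal_def
proof (intro allI impI)
  fix X :: "'x metric" assume X: "polish_metric X"
  show "\<exists>f. isometric_embedding X U f"
  \<comment> \<open>The empty space has no dense sequence. Otherwise an embedding without prescribed
    values is needed, hence \<open>m = 0\<close>.\<close>
  proof (cases "mspace X = {}")
    case True
    then show ?thesis by (auto simp: isometric_embedding_def)
  next
    case False
    with X show ?thesis
      using extend_to_embedding[OF assms, of X 0 "\<lambda>_. undefined" "\<lambda>_. undefined"]
      by (simp add: polish_metric_def)
  qed
qed

lemma finite_polish_metric:
  assumes "finite (mspace X)"
  shows "polish_metric X"
proof -
  interpret Metric_space "mspace X" "mdist X" by simp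
  have "compact_space mtopology"
    using assms by (simp add: compact_space_def finite_imp_compactin)
  then have "mcomplete" by (rule compact_space_imp_mcomplete)
  moreover have "separable_space mtopology"
    unfolding separable_space_def using assms
    by (intro exI[of _ "mspace X"]) (metis closure_of_topspace countable_finite order_refl topspace_mtopology)
  ultimately show ?thesis
    by (simp add: polish_metric_def mcomplete_of_def mtopology_of_def)
qed

text \<open>The partial isometry to be extended undoes \<iota>: it leads from the image of
  \<open>F\<close> in \<open>F'\<close> back to \<open>F\<close> in \<open>U\<close>.\<close>

lemma extension_property_finite_extension:
  assumes "mcomplete_of U" "extension_property U"
  shows "finite_extension_property TYPE('f) U"
  unfolding finite_extension_property_def
proof (intro allI impI, elim conjE)
  fix F \<iota> and F' :: "'f metric"
  assume F: "F \<subseteq> mspace U" "finite F" and F': "finite (mspace F')"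
    and \<iota>: "isometric_embedding (submetric U F) F' \<iota>"
  have \<iota>': "\<iota> x \<in> mspace F'" "mdist F' (\<iota> x) (\<iota> y) = mdist U x y" if "x \<in> F" "y \<in> F" for x y
    using \<iota> F(1) that by (auto simp: isometric_embedding_def)
  show "\<exists>I. isometric_embedding F' U I \<and> (\<forall>x\<in>F. I (\<iota> x) = x)"
  proof (cases "mspace F' = {}")
    case True
    then show ?thesis using \<iota>'(1) by (auto simp: isometric_embedding_def)
  next
    case False
    obtain y n where y: "F = y ` {i. i < (n :: nat)}"
      using finite_imp_nat_seg_image_inj_on[OF F(2)] by blast
    have sep: "separable_space (mtopology_of F')"
      using finite_polish_metric[OF F'] by (simp add: polish_metric_def)
    have "\<exists>I. isometric_embedding F' U I \<and> (\<forall>i<n. I ((\<iota> \<circ> y) i) = y i)"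
      by (rule extend_to_embedding[OF assms sep False, of n "\<iota> \<circ> y" y])
        (use \<iota>' F(1) y in auto)
    with y show ?thesis by auto
  qed
qed

text \<open>Add one point at the prescribed distances to the given finite set, embed the result by
  universality and move the image of the finite set back by homogeneity.\<close>

lemma urysohn_space_extension_property:
  fixes U :: "'u metric"
  assumes U: "urysohn_space U"
  shows "extension_property U"
  unfolding extension_property_def
proof (intro allI impI, elim conjE)
  fix n and x :: "nat \<Rightarrow> 'u" and a :: "nat \<Rightarrow> real"
  assume x: "\<forall>i<n. x i \<in> mspace U" and a: "a \<in> admissible_vectors n (distance_matrix U x)"
  have a1: "\<bar>a i - a j\<bar> \<le> mdist U (x i) (x j)" "mdist U (x i) (x j) \<le> a i + a j" if "i < n" "j < n" for i j
    using a that by (auto simp: admissible_vectors_def distance_matrix_def)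
  have nonneg: "0 \<le> a i" if "i < n" for i
    using a1(2)[OF that that] mdist_self[of "x i" U] x that by simp
  show "\<exists>z\<in>mspace U. \<forall>i<n. mdist U (x i) z = a i"
  \<comment> \<open>A new point at distance \<open>0\<close> would violate the metric axioms; here
    \<open>x k\<close> itself is the solution.\<close>
  proof (cases "\<exists>k<n. a k = 0")
    case True
    then obtain k where k: "k < n" "a k = 0" by blast
    have "mdist U (x i) (x k) = a i" if "i < n" for i
      using a1[OF that k(1)] k(2) nonneg[OF that] by simp
    then show ?thesis using x k(1) by blast
  next
    case False
    then have pos: "0 < a i" if "i < n" for i
      using nonneg[OF that] that by force
    \<comment> \<open>Equal points carry equal values of \<open>a\<close>, so the chosen index does
      not matter. The absolute value keeps \<open>g\<close> nonnegative off the family, since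
      \<open>Metric_space\<close> demands a nonnegative distance on the whole type.\<close>
    define g where "g u = \<bar>a (SOME i. i < n \<and> x i = u)\<bar>" for u
    have g: "g (x i) = a i" if "i < n" for i
    proof -
      have "(SOME j. j < n \<and> x j = x i) < n \<and> x (SOME j. j < n \<and> x j = x i) = x i"
        by (rule someI[of _ i]) (use that in simp)
      then show ?thesis
        using a1(1)[of "SOME j. j < n \<and> x j = x i" i] nonneg[OF that] that x
        unfolding g_def by simp
    qed
    have g_nonneg: "0 \<le> g (x i)" if "i < n" for i using g nonneg that by simp
    define M where "M = insert None (Some ` x ` {..<n})"
    define D where "D p q = (case (p, q) of (None, None) \<Rightarrow> 0 | (None, Some v) \<Rightarrow> g v
        | (Some u, None) \<Rightarrow> g u | (Some u, Some v) \<Rightarrow> mdist U u v)" for p q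
    have M: "p = None \<or> (\<exists>i<n. p = Some (x i))" if "p \<in> M" for p
      using that by (auto simp: M_def)
    have D: "Metric_space M D"
    proof
      show "0 \<le> D p q" for p q
        by (auto simp: D_def g_def split: option.splits)
      show "D p q = D q p" for p q
        by (auto simp: D_def mdist_commute split: option.splits)
      show "D p q = 0 \<longleftrightarrow> p = q" if "p \<in> M" "q \<in> M" for p q
        using M[OF that(1)] M[OF that(2)] pos x by (force simp: D_def g)
      show "D p l \<le> D p q + D q l" if pql: "p \<in> M" "q \<in> M" "l \<in> M" for p q l
      proof -
        have bound: "g (x i) \<le> mdist U (x i) (x j) + g (x j)"
          "mdist U (x i) (x j) \<le> g (x i) + g (x j)" if "i < n" "j < n" for i j
          using a1[OF that] g that by simp_all
        show ?thesis
          using M[OF pql(1)] M[OF pql(2)] M[OF pql(3)] x bound g_nonneg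
          by (elim disjE exE conjE) (simp_all add: D_def mdist_triangle mdist_commute add.commute)
      qed
    qed
    define X where "X = metric (M, D)"
    have X: "mspace X = M" "mdist X = D"
      using D by (simp_all add: X_def Metric_space.mspace_metric Metric_space.mdist_metric)
    have "polish_metric X" by (rule finite_polish_metric) (simp add: X M_def)
    \<comment> \<open>The new point \<open>None\<close> puts the carrier into
      \<open>'u option\<close>, so universality must be transferred from real carriers to this
      type.\<close>
    then obtain h where h: "isometric_embedding X U h"
      using U polish_universal_real unfolding urysohn_space_def polish_universal_def by blast
    have hU: "h p \<in> mspace U" if "p \<in> M" for p
      using h that X by (auto simp: isometric_embedding_def)
    have hD: "mdist U (h p) (h q) = D p q" if "p \<in> M" "q \<in> M" for p q
      using h that X by (simp add: isometric_embedding_def)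
    have in_M: "None \<in> M" "\<And>i. i < n \<Longrightarrow> Some (x i) \<in> M" by (auto simp: M_def)
    have homog: "finite_homogeneous U" using U by (simp add: urysohn_space_def)
    have "\<exists>J. isometry_onto U U J \<and> (\<forall>i<n. J (h (Some (x i))) = x i)"
      using homog[unfolded finite_homogeneous_def, rule_format, of n "\<lambda>i. h (Some (x i))" x]
        x hU hD in_M by (auto simp: D_def)
    then obtain J where J: "isometry_onto U U J" "\<And>i. i < n \<Longrightarrow> J (h (Some (x i))) = x i"
      by blast
    have J_iso: "J u \<in> mspace U" "mdist U (J u) (J v) = mdist U u v"
      if "u \<in> mspace U" "v \<in> mspace U" for u v
      using J(1) that by (auto simp: isometry_onto_def isometric_embedding_def)
    have "mdist U (x i) (J (h None)) = a i" if i: "i < n" for i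
    proof -
      have "mdist U (x i) (J (h None)) = mdist U (J (h (Some (x i)))) (J (h None))"
        using J(2) i by simp
      also have "\<dots> = D (Some (x i)) None"
        using J_iso(2) hU hD in_M i by simp
      finally show ?thesis using g i by (simp add: D_def)
    qed
    then show ?thesis using J_iso(1)[of "h None" "h None"] hU in_M by blast
  qed
qed

section \<open>Completions of universal matrices and dense sequences of the Urysohn space\<close>

text \<open>The map \<open>e\<close> is itself a dense sequence with distance matrix
  \<open>r\<close>, so universality of \<open>r\<close> gives approximate extension in
  \<open>U\<close>, and completeness makes it exact.\<close>

lemma completion_extension_property:
  assumes "universal_matrix r" "proper_matrix r" "is_completion (matrix_metric r) U e"
  shows "extension_property U" "polish_metric U"
proof -
  have r: "r \<in> distance_matrices" using assms(1) by (simp add: universal_matrix_def)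
  note dense = dense_sequence_completion[OF r assms(2,3)]
  then show "polish_metric U" by blast
  then show "extension_property U"
    using universal_dense_imp_approx[OF dense(1)] assms(1) dense(2)
    by (intro extension_property_if_approx) (auto simp: polish_metric_def)
qed

text \<open>For a universal \<open>r\<close>, the completion of its metric and \<open>U\<close> both
  have the extension property, so an isometry carries the dense copy of the indices into
  \<open>U\<close>; properness makes the result injective.\<close>

lemma universal_matrix_iff_dense_sequence:
  fixes U :: "'u metric"
  assumes U: "urysohn_space U" and r: "r \<in> distance_matrices" "proper_matrix r"
  shows "universal_matrix r \<longleftrightarrow> (\<exists>x. dense_sequence U x \<and> inj x \<and> r = distance_matrix U x)"
proof
  have U': "extension_property U" "polish_metric U"
    using U urysohn_space_extension_property by (auto simp: urysohn_space_def)
  assume univ: "universal_matrix r"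
  obtain Y :: "(nat \<Rightarrow> real) metric" and e where Y: "is_completion (matrix_metric r) Y e"
    using completion_exists by blast
  note e = dense_sequence_completion[OF r Y]
  obtain J where J: "isometry_onto Y U J"
    using extend_to_isometry[OF completion_extension_property(2,1)[OF univ r(2) Y] U'(2,1),
        of 0 "\<lambda>_. undefined" "\<lambda>_. undefined"] by auto
  then have J': "J ` mspace Y = mspace U"
    "\<And>u v. u \<in> mspace Y \<Longrightarrow> v \<in> mspace Y \<Longrightarrow> mdist U (J u) (J v) = mdist Y u v"
    by (auto simp: isometry_onto_def isometric_embedding_def)
  have eY: "e i \<in> mspace Y" for i using e(1) by (auto simp: dense_sequence_def)
  have dist: "mdist U (J (e i)) (J (e j)) = r i j" for i j
    using J'(2)[OF eY eY] e(2) by (auto simp: distance_matrix_def fun_eq_iff)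
  have "dense_sequence U (J \<circ> e)"
    unfolding dense_sequence_iff
  proof (intro conjI ballI allI impI)
    show "range (J \<circ> e) \<subseteq> mspace U" using J'(1) eY by auto
    fix u and \<epsilon> :: real assume "u \<in> mspace U" "\<epsilon> > 0"
    then obtain w where w: "w \<in> mspace Y" "u = J w" using J'(1) by blast
    then obtain i where "mdist Y w (e i) < \<epsilon>"
      using e(1) \<open>\<epsilon> > 0\<close> unfolding dense_sequence_iff by blast
    then show "\<exists>i. mdist U u ((J \<circ> e) i) < \<epsilon>"
      using J'(2)[OF w(1) eY] w(2) by auto
  qed
  moreover have "inj (J \<circ> e)"
  proof (rule injI, rule ccontr)
    fix i j assume "(J \<circ> e) i = (J \<circ> e) j" "i \<noteq> j"
    then have "r i j = r j j" using dist[of i j] dist[of j j] by simp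
    moreover have "r j j = 0" using r(1) by (simp add: distance_matrices_def)
    moreover have "0 < r i j" using r(2) \<open>i \<noteq> j\<close> by (simp add: proper_matrix_def)
    ultimately show False by simp
  qed
  moreover have "r = distance_matrix U (J \<circ> e)"
    by (simp add: distance_matrix_def dist fun_eq_iff)
  ultimately show "\<exists>x. dense_sequence U x \<and> inj x \<and> r = distance_matrix U x" by blast
next
  assume "\<exists>x. dense_sequence U x \<and> inj x \<and> r = distance_matrix U x"
  then show "universal_matrix r"
    using extension_property_imp_universal urysohn_space_extension_property[OF U] by blast
qed

theorem theorem3:
  shows
    "(\<forall>r (U :: 'u metric) e.
        universal_matrix r \<and> proper_matrix r \<and> is_completion (matrix_metric r) U e \<longrightarrow>
        urysohn_space U \<and>
        polish_metric U \<and>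
        polish_universal TYPE('x) U \<and>
        finite_homogeneous U \<and>
        finite_extension_property TYPE('f) U) \<and>
     (\<forall>r r' (U :: 'u metric) e (U' :: 'v metric) e'.
        universal_matrix r \<and> proper_matrix r \<and> is_completion (matrix_metric r) U e \<and>
        universal_matrix r' \<and> proper_matrix r' \<and> is_completion (matrix_metric r') U' e' \<longrightarrow>
        isometric_spaces U U') \<and>
     (\<forall>U :: 'u metric. urysohn_space U \<longrightarrow>
        (\<forall>r. r \<in> distance_matrices \<and> proper_matrix r \<longrightarrow>
           (universal_matrix r \<longleftrightarrow>
              (\<exists>x. dense_sequence U x \<and> inj x \<and> r = distance_matrix U x))) \<and>
        (\<forall>x. dense_sequence U x \<longrightarrow> universal_matrix (distance_matrix U x)))"
proof (intro conjI allI impI; (elim conjE)?)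
  fix r and U :: "'u metric" and e
  assume r: "universal_matrix r" "proper_matrix r" "is_completion (matrix_metric r) U e"
  note U = completion_extension_property[OF r]
  then have "mcomplete_of U" by (simp add: polish_metric_def)
  with U show "polish_metric U" "polish_universal TYPE('x) U" "finite_homogeneous U"
    "finite_extension_property TYPE('f) U" "urysohn_space U"
    by (simp_all add: urysohn_space_def extension_property_homogeneous
        extension_property_polish_universal extension_property_finite_extension)
next
  fix r r' and U :: "'u metric" and e and U' :: "'v metric" and e'
  assume r: "universal_matrix r" "proper_matrix r" "is_completion (matrix_metric r) U e"
    and r': "universal_matrix r'" "proper_matrix r'" "is_completion (matrix_metric r') U' e'"
  \<comment> \<open>Back and forth starting from the empty partial isometry.\<close>
  show "isometric_spaces U U'"
    using extend_to_isometry[OF completion_extension_property(2,1)[OF r]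
        completion_extension_property(2,1)[OF r'],
        of 0 "\<lambda>_. undefined" "\<lambda>_. undefined"]
    by (simp add: isometric_spaces_def)
next
  fix U :: "'u metric" and r
  assume "urysohn_space U" "r \<in> distance_matrices" "proper_matrix r"
  then show "universal_matrix r \<longleftrightarrow>
      (\<exists>x. dense_sequence U x \<and> inj x \<and> r = distance_matrix U x)"
    by (rule universal_matrix_iff_dense_sequence)
next
  fix U :: "'u metric" and x
  assume "urysohn_space U" "dense_sequence U x"
  then show "universal_matrix (distance_matrix U x)"
    by (intro extension_property_imp_universal urysohn_space_extension_property)
qed

end
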